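(* Let $G$ be a finite group with identity $e$ and $|G|=m$, and let $S,T\subseteq G\setminus\{e\}$ be disjoint with $G\setminus\{e\}=S\cup T$. Suppose $S=S^{-1}$ and $T=T^{-1}$. Let $n=m+1$ and $\mu=|S|-|T|$. Then there exists a $k$ such that $S$ is a quasi-signature set for an $(n,k)$-equiangular frame if and only if for all $g\in S$ $$N_{(S,S)}^g=\frac{n+3\mu-6}{4}$$ and for all $h\in T$ $$N_{(T,T)}^h=\frac{n-3\mu-6}{4}.$$ Here $k$ and $\mu$ are related by $$\mu=(n-2k)\sqrt{\frac{n-1}{k(n-k)}},\qquad k=\frac n2-\frac{\mu n}{2\sqrt{4(n-1)+\mu^2}}.$$
   Context: For subsets $A,B\subseteq G$ and $g\in G$, $N_{(A,B)}^g=\#\{(g_1,g_2)\in A\times B: g_1g_2=g\}$, and $A^{-1}=\{a^{-1}:a\in A\}$. An $(n,k)$-frame is a Parseval frame $\{f_1,\dots,f_n\}$ for $\mathbb C^k$, i.e. $\sum_{j}|\langle x,f_j\rangle|^2=\|x\|^2$ for all $x\in\mathbb C^k$. It is equiangular if all $f_i\neq 0$ and there is a constant $b$ with $|\langle f_i/\|f_i\|,f_j/\|f_j\|\rangle|=b$ for all $i\ne j$. For $1\le k<n$, put $c_{n,k}=\sqrt{\frac{k(n-k)}{n^2(n-1)}}$. A self-adjoint $n\times n$ matrix $Q$ with $Q_{ii}=0$ and $|Q_{ij}|=1$ for $i\neq j$ is the signature matrix of an $(n,k)$-equiangular frame if there is an equiangular $(n,k)$-frame whose Gram matrix $(\langle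 f_j,f_i\rangle)_{i,j}$ equals $\frac kn I_n+c_{n,k}Q$. Throughout $1\le k<n$. Let $\lambda$ be the left regular representation of $G$: $\lambda(g)e_h=e_{gh}$ on the vector space with basis $\{e_h\}_{h\in G}$, regarded as $m\times m$ permutation matrices. For $S\subseteq G\setminus\{e\}$ and $T=(G\setminus\{e\})\setminus S$, let $Q=\sum_{g\in S}\lambda(g)-\sum_{h\in T}\lambda(h)$ and let $\tilde Q=\begin{bmatrix}0&C^t\\ C&Q\end{bmatrix}$, where $C\in\mathbb C^m$ is the all-ones column vector. With $n=m+1$, $S$ is a quasi-signature set for an $(n,k)$-equiangular frame if the $n\times n$ matrix $\tilde Q$ is the signature matrix of an $(n,k)$-equiangular frame. *)

theory Defs
  imports "HOL-Algebra.Coset" "Jordan_Normal_Form.Schur_Decomposition"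
begin

text \<open>
  Vectors of the \<open>k\<close>-dimensional complex space are elements of \<open>carrier_vec k\<close>; the inner product
  of \<open>x\<close> and \<open>y\<close> is \<open>x \<bullet>c y\<close>, linear in the first and conjugate linear in the second argument.
  A frame with \<open>n\<close> members is a family indexed by \<open>{..<n}\<close>, so repeated members are counted
  with multiplicity; values \<open>f j\<close> with \<open>j \<ge> n\<close> are irrelevant.
\<close>

definition cvec_norm :: "complex vec \<Rightarrow> real" where
  "cvec_norm x = sqrt (Re (x \<bullet>c x))"

definition parseval_frame :: "nat \<Rightarrow> nat \<Rightarrow> (nat \<Rightarrow> complex vec) \<Rightarrow> bool" where
  "parseval_frame n k f \<longleftrightarrow>
     (\<forall>j<n. f j \<in> carrier_vec k) \<and>
     (\<forall>x\<in>carrier_vec k. (\<Sum>j<n. (cmod (x \<bullet>c f j))\<^sup>2) = (cvec_norm x)\<^sup>2)"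

definition normalized_vec :: "complex vec \<Rightarrow> complex vec" where
  "normalized_vec x = complex_of_real (1 / cvec_norm x) \<cdot>\<^sub>v x"

definition equiangular_frame :: "nat \<Rightarrow> nat \<Rightarrow> (nat \<Rightarrow> complex vec) \<Rightarrow> bool" where
  "equiangular_frame n k f \<longleftrightarrow>
     parseval_frame n k f \<and>
     (\<forall>i<n. f i \<noteq> 0\<^sub>v k) \<and>
     (\<exists>b::real. \<forall>i<n. \<forall>j<n. i \<noteq> j \<longrightarrow>
        cmod (normalized_vec (f i) \<bullet>c normalized_vec (f j)) = b)"

definition gram_mat :: "nat \<Rightarrow> (nat \<Rightarrow> complex vec) \<Rightarrow> complex mat" where
  "gram_mat n f = mat n n (\<lambda>(i, j). f j \<bullet>c f i)"

definition frame_const :: "nat \<Rightarrow> nat \<Rightarrow> real" where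
  "frame_const n k = sqrt (real k * (real n - real k) / ((real n)\<^sup>2 * (real n - 1)))"

definition signature_matrix :: "nat \<Rightarrow> nat \<Rightarrow> complex mat \<Rightarrow> bool" where
  "signature_matrix n k Q \<longleftrightarrow>
     1 \<le> k \<and> k < n \<and>
     Q \<in> carrier_mat n n \<and> mat_adjoint Q = Q \<and>
     (\<forall>i<n. Q $$ (i, i) = 0) \<and>
     (\<forall>i<n. \<forall>j<n. i \<noteq> j \<longrightarrow> cmod (Q $$ (i, j)) = 1) \<and>
     (\<exists>f. equiangular_frame n k f \<and>
        gram_mat n f = complex_of_real (real k / real n) \<cdot>\<^sub>m 1\<^sub>m n
                       + complex_of_real (frame_const n k) \<cdot>\<^sub>m Q)"

definition num_factorizations ::
  "('a, 'b) monoid_scheme \<Rightarrow> 'a set \<Rightarrow> 'a set \<Rightarrow> 'a \<Rightarrow> nat" where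
  "num_factorizations G A B g = card {(g1, g2). g1 \<in> A \<and> g2 \<in> B \<and> g1 \<otimes>\<^bsub>G\<^esub> g2 = g}"

text \<open>
  Matrices have rows and columns numbered by natural numbers, so the basis indexed by the group
  is numbered by an enumeration \<open>e\<close>, intended to be a bijection from \<open>{..<card (carrier G)}\<close> to
  \<open>carrier G\<close>. Column \<open>j\<close> of \<open>left_regular G e g\<close> is the basis vector of \<open>g \<otimes> e j\<close>.
\<close>

definition left_regular ::
  "('a, 'b) monoid_scheme \<Rightarrow> (nat \<Rightarrow> 'a) \<Rightarrow> 'a \<Rightarrow> complex mat" where
  "left_regular G e g =
     mat (card (carrier G)) (card (carrier G)) (\<lambda>(i, j). if e i = g \<otimes>\<^bsub>G\<^esub> e j then 1 else 0)"

definition Q_mat ::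
  "('a, 'b) monoid_scheme \<Rightarrow> (nat \<Rightarrow> 'a) \<Rightarrow> 'a set \<Rightarrow> complex mat" where
  "Q_mat G e S =
     (let M = module_mat TYPE(complex) (card (carrier G)) (card (carrier G)); T = (carrier G - {\<one>\<^bsub>G\<^esub>}) - S
      in finsum M (left_regular G e) S - finsum M (left_regular G e) T)"

definition Q_tilde_mat ::
  "('a, 'b) monoid_scheme \<Rightarrow> (nat \<Rightarrow> 'a) \<Rightarrow> 'a set \<Rightarrow> complex mat" where
  "Q_tilde_mat G e S =
     (let C = mat (card (carrier G)) 1 (\<lambda>_. 1)
      in four_block_mat (0\<^sub>m 1 1) (transpose_mat C) C (Q_mat G e S))"

definition quasi_signature_set ::
  "('a, 'b) monoid_scheme \<Rightarrow> (nat \<Rightarrow> 'a) \<Rightarrow> 'a set \<Rightarrow> nat \<Rightarrow> nat \<Rightarrow> bool" where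
  "quasi_signature_set G e S n k \<longleftrightarrow>
     S \<subseteq> carrier G - {\<one>\<^bsub>G\<^esub>} \<and> n = card (carrier G) + 1 \<and> signature_matrix n k (Q_tilde_mat G e S)"

end

theory Submission
  imports Defs
begin

text \<open>
  The Gram matrix of a Parseval frame is an orthogonal projection, and every orthogonal projection
  is the Gram matrix of a Parseval frame whose dimension is its rank. Hence, for \<open>n \<ge> 2\<close>, a zero-diagonal,
  self-adjoint \<open>n \<times> n\<close> matrix \<open>Q\<close> with unimodular off-diagonal entries is a signature matrix iff some
  \<open>a I + c Q\<close> with \<open>c > 0\<close> is idempotent, that is, iff \<open>Q\<^sup>2 = (n - 1) I + \<nu> Q\<close> for some real \<open>\<nu>\<close>.
  The dimension \<open>k\<close> is then the trace of the projection, and comparing coefficients expresses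
  \<open>\<nu>\<close> and \<open>k\<close> in terms of each other
  (\<open>signature_matrix_square\<close>, \<open>signature_matrix_if_square\<close>, \<open>dimension_from_frame_parameter\<close>).

  For the bordered matrix of \<open>S\<close>, the entries of the first row in this equation say that \<open>\<nu>\<close> is the
  common row sum of \<open>Q\<close>, which is \<open>\<mu> = |S| - |T|\<close>. The entries of the block \<open>Q\<close> depend only on
  \<open>e i \<otimes> inv (e j)\<close>: they are values of the function \<open>\<sigma>\<close> that is \<open>1\<close> on \<open>S\<close>, \<open>-1\<close> on \<open>T\<close> and \<open>0\<close> at
  the identity. The equation thus turns into \<open>1 + (\<sigma> * \<sigma>) g = \<mu> \<sigma> g\<close> for all \<open>g \<noteq> \<one>\<close>
  (\<open>Q_tilde_square_iff\<close>). Finally \<open>\<sigma>\<close> is \<open>2 \<cdot> 1\<^sub>S\<close> plus the indicator of the identity minus \<open>1\<close>, so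
  that on \<open>S\<close> the convolution is \<open>4 N\<^sub>S\<^sub>S\<close> plus a constant; passing from \<open>\<sigma>\<close> to \<open>- \<sigma>\<close>
  gives the same on \<open>T\<close> (\<open>sign_convolution_on_set\<close>).
\<close>

section \<open>Gram matrices of Parseval frames are projections\<close>

lemma cscalar_prod_conv_sum:
  assumes "y \<in> carrier_vec k"
  shows "x \<bullet>c y = (\<Sum>l<k. x $ l * cnj (y $ l))"
  using assms by (auto simp: scalar_prod_def lessThan_atLeast0 intro!: sum.cong)

lemma cscalar_prod_swap:
  fixes x y :: "complex vec"
  assumes "x \<in> carrier_vec k" "y \<in> carrier_vec k"
  shows "y \<bullet>c x = cnj (x \<bullet>c y)"
  unfolding cscalar_prod_conv_sum[OF assms(1)] cscalar_prod_conv_sum[OF assms(2)]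
  by (simp add: mult.commute)

lemma cvec_norm_square:
  assumes "x \<in> carrier_vec k"
  shows "complex_of_real ((cvec_norm x)\<^sup>2) = x \<bullet>c x"
proof -
  have "x \<bullet>c x = complex_of_real (\<Sum>l<k. (cmod (x $ l))\<^sup>2)"
    by (simp add: cscalar_prod_conv_sum[OF assms] complex_norm_square flip: of_real_power)
  then show ?thesis by (simp add: cvec_norm_def sum_nonneg)
qed

text \<open>
  The Parseval identity compares two Hermitian forms on the diagonal; by polarization, with the
  scalars \<open>1\<close> and \<open>\<i>\<close>, they agree everywhere.
\<close>
lemma parseval_frame_polarization:
  assumes pf: "parseval_frame n k f"
    and x: "x \<in> carrier_vec k" and y: "y \<in> carrier_vec k"
  shows "(\<Sum>j<n. (x \<bullet>c f j) * cnj (y \<bullet>c f j)) = x \<bullet>c y"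
proof -
  define B where "B x y = (\<Sum>j<n. (x \<bullet>c f j) * cnj (y \<bullet>c f j)) - x \<bullet>c y" for x y
  have f: "f j \<in> carrier_vec k" if "j < n" for j
    using pf that by (simp add: parseval_frame_def)
  have diag: "B v v = 0" if v: "v \<in> carrier_vec k" for v
  proof -
    have "(\<Sum>j<n. (v \<bullet>c f j) * cnj (v \<bullet>c f j))
        = complex_of_real (\<Sum>j<n. (cmod (v \<bullet>c f j))\<^sup>2)"
      by (simp add: complex_norm_square flip: of_real_power)
    also have "\<dots> = complex_of_real ((cvec_norm v)\<^sup>2)"
      using pf v by (simp add: parseval_frame_def)
    finally show ?thesis unfolding B_def cvec_norm_square[OF v] by simp
  qed
  have lin: "(x + c \<cdot>\<^sub>v y) \<bullet>c v = x \<bullet>c v + c * (y \<bullet>c v)" if v: "v \<in> carrier_vec k" for v c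
    unfolding cscalar_prod_conv_sum[OF v] sum_distrib_left sum.distrib[symmetric]
    using x y by (intro sum.cong refl) (simp add: algebra_simps)
  have expand: "B (x + c \<cdot>\<^sub>v y) (x + c \<cdot>\<^sub>v y) = B x x + c * B y x + cnj c * B x y + c * cnj c * B y y"
    for c
  proof -
    have z: "x + c \<cdot>\<^sub>v y \<in> carrier_vec k" using x y by simp
    have 1: "(x + c \<cdot>\<^sub>v y) \<bullet>c (x + c \<cdot>\<^sub>v y)
        = x \<bullet>c x + c * (y \<bullet>c x) + cnj c * (x \<bullet>c y) + c * cnj c * (y \<bullet>c y)"
      unfolding cscalar_prod_conv_sum[OF z] cscalar_prod_conv_sum[OF x] cscalar_prod_conv_sum[OF y]
        sum_distrib_left sum.distrib[symmetric]
      using x y by (intro sum.cong refl) (simp add: algebra_simps)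
    have 2: "(\<Sum>j<n. ((x + c \<cdot>\<^sub>v y) \<bullet>c f j) * cnj ((x + c \<cdot>\<^sub>v y) \<bullet>c f j))
      = (\<Sum>j<n. (x \<bullet>c f j) * cnj (x \<bullet>c f j)) + c * (\<Sum>j<n. (y \<bullet>c f j) * cnj (x \<bullet>c f j))
        + cnj c * (\<Sum>j<n. (x \<bullet>c f j) * cnj (y \<bullet>c f j))
        + c * cnj c * (\<Sum>j<n. (y \<bullet>c f j) * cnj (y \<bullet>c f j))"
      unfolding sum_distrib_left sum.distrib[symmetric]
      by (intro sum.cong refl) (simp add: lin f algebra_simps)
    show ?thesis unfolding B_def 1 2 by (simp add: algebra_simps)
  qed
  have "B (x + c \<cdot>\<^sub>v y) (x + c \<cdot>\<^sub>v y) = 0" for c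
    using x y by (intro diag) simp
  then have eq: "c * B y x + cnj c * B x y = 0" for c
    using expand[of c] diag[OF x] diag[OF y] by simp
  have "B x y = 0"
    using eq[of 1] eq[of \<i>] by (simp add: complex_eq_iff)
  then show ?thesis by (simp add: B_def)
qed

text \<open>
  An entry of the squared Gram matrix is the polarized Parseval sum of two frame members.
\<close>
lemma gram_mat_idempotent:
  assumes pf: "parseval_frame n k f" and "i < n" "l < n"
  shows "(\<Sum>j<n. gram_mat n f $$ (i, j) * gram_mat n f $$ (j, l)) = gram_mat n f $$ (i, l)"
proof -
  have f: "f j \<in> carrier_vec k" if "j < n" for j
    using pf that by (simp add: parseval_frame_def)
  have "(\<Sum>j<n. gram_mat n f $$ (i, j) * gram_mat n f $$ (j, l))
      = (\<Sum>j<n. (f l \<bullet>c f j) * cnj (f i \<bullet>c f j))"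
  proof (intro sum.cong refl)
    fix j assume "j \<in> {..<n}"
    then show "gram_mat n f $$ (i, j) * gram_mat n f $$ (j, l) = (f l \<bullet>c f j) * cnj (f i \<bullet>c f j)"
      using assms cscalar_prod_swap[OF f[of i] f[of j]] by (simp add: gram_mat_def mult.commute)
  qed
  also have "\<dots> = f l \<bullet>c f i"
    using assms by (intro parseval_frame_polarization[OF pf] f)
  finally show ?thesis using assms by (simp add: gram_mat_def)
qed

text \<open>
  This is \<open>(a I + c q)\<^sup>2 = a\<^sup>2 I + 2 a c q + c\<^sup>2 q\<^sup>2\<close> for entries; both directions of the
  characterization of signature matrices read it off.
\<close>
lemma sum_scaled_shift_square:
  fixes q :: "nat \<Rightarrow> nat \<Rightarrow> 'a::comm_ring_1"
  assumes "i < n" "l < n"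
  shows "(\<Sum>j<n. ((if i = j then a else 0) + c * q i j) * ((if j = l then a else 0) + c * q j l))
    = (if i = l then a\<^sup>2 else 0) + 2 * a * c * q i l + c\<^sup>2 * (\<Sum>j<n. q i j * q j l)"
proof -
  have "(\<Sum>j<n. ((if i = j then a else 0) + c * q i j) * ((if j = l then a else 0) + c * q j l))
    = (\<Sum>j<n. (if i = j then a * (if j = l then a else 0) + a * c * q j l else 0)
        + (if j = l then a * c * q i j else 0) + c\<^sup>2 * (q i j * q j l))"
    by (intro sum.cong refl) (simp add: algebra_simps power2_eq_square)
  also have "\<dots> = (if i = l then a\<^sup>2 else 0) + 2 * a * c * q i l + c\<^sup>2 * (\<Sum>j<n. q i j * q j l)"
    using assms by (simp add: sum.distrib sum_distrib_left power2_eq_square)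
  finally show ?thesis .
qed

lemma mat_adjoint_eq_self_iff:
  fixes Q :: "complex mat"
  assumes "Q \<in> carrier_mat n n"
  shows "mat_adjoint Q = Q \<longleftrightarrow> (\<forall>i<n. \<forall>j<n. Q $$ (j, i) = cnj (Q $$ (i, j)))"
proof -
  have "mat_adjoint Q = mat n n (\<lambda>(i, j). cnj (Q $$ (j, i)))"
    using assms by (intro eq_matI) (auto simp: mat_adjoint_def mat_of_rows_def)
  then have "mat_adjoint Q = Q \<longleftrightarrow> (\<forall>j<n. \<forall>i<n. cnj (Q $$ (i, j)) = Q $$ (j, i))"
    using assms by (simp only: mat_eq_iff) auto
  then show ?thesis by metis
qed

section \<open>The parameters of an equiangular frame\<close>

text \<open>
  With \<open>a = k / n\<close> and \<open>c = frame_const n k\<close> this says \<open>(n - 1) c\<^sup>2 = a - a\<^sup>2\<close>, which is the diagonal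
  of the idempotency equation for \<open>a I + c Q\<close>.
\<close>
lemma frame_const_square:
  assumes "k < n" "n \<ge> 2"
  shows "(real n - 1) * (frame_const n k)\<^sup>2 = real k / real n - (real k / real n)\<^sup>2"
proof -
  have "(frame_const n k)\<^sup>2 = real k * (real n - real k) / ((real n)\<^sup>2 * (real n - 1))"
    using assms unfolding frame_const_def by (intro real_sqrt_pow2) simp
  then show ?thesis using assms by (simp add: field_simps power2_eq_square)
qed

text \<open>
  The coefficient \<open>\<nu>\<close> in \<open>Q\<^sup>2 = (n - 1) I + \<nu> Q\<close>, which is the sum of the two eigenvalues of the
  signature matrix \<open>Q\<close>.
\<close>
definition frame_parameter :: "nat \<Rightarrow> nat \<Rightarrow> real" where
  "frame_parameter n k = (real n - 2 * real k) * sqrt ((real n - 1) / (real k * (real n - real k)))"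

lemma frame_const_pos:
  assumes "1 \<le> k" "k < n"
  shows "frame_const n k > 0"
  using assms by (simp add: frame_const_def)

lemma frame_parameter_times_frame_const:
  assumes "1 \<le> k" "k < n"
  shows "frame_parameter n k * frame_const n k = 1 - 2 * (real k / real n)"
proof -
  have n: "real n > 1" "real k > 0" "real n > real k" using assms by auto
  have "sqrt ((real n - 1) / (real k * (real n - real k))) * frame_const n k
      = sqrt ((1 / real n)\<^sup>2)"
    unfolding frame_const_def real_sqrt_mult[symmetric]
  proof (rule arg_cong[of _ _ sqrt])
    have "D \<noteq> 0 \<Longrightarrow> E \<noteq> 0 \<Longrightarrow> E / D * (D / ((real n)\<^sup>2 * E)) = (1 / real n)\<^sup>2" for D E
      by (simp add: power_divide)
    from this[of "real k * (real n - real k)" "real n - 1"]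
    show "(real n - 1) / (real k * (real n - real k))
      * (real k * (real n - real k) / ((real n)\<^sup>2 * (real n - 1))) = (1 / real n)\<^sup>2"
      using n by simp
  qed
  also have "\<dots> = 1 / real n" using n by simp
  finally have "frame_parameter n k * frame_const n k = (real n - 2 * real k) * (1 / real n)"
    unfolding frame_parameter_def mult.assoc by (rule arg_cong)
  then show ?thesis using n by (simp add: field_simps)
qed

text \<open>
  The eigenvalues of a signature matrix are the roots of \<open>x\<^sup>2 - \<mu> x - (n - 1)\<close>, whose distance is
  the square root in the denominator. An affine map of slope \<open>frame_const n k\<close> takes them to the eigenvalues \<open>0\<close> and
  \<open>1\<close> of the Gram matrix, so the square root is the reciprocal of \<open>frame_const n k\<close>.
\<close>
lemma dimension_from_frame_parameter:
  assumes "1 \<le> k" "k < n"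
  defines "\<mu> \<equiv> frame_parameter n k"
  shows "real k = real n / 2 - \<mu> * real n / (2 * sqrt (4 * (real n - 1) + \<mu>\<^sup>2))"
proof -
  define c where "c = frame_const n k"
  have c: "c > 0" using assms by (simp add: c_def frame_const_pos)
  have n: "real n > 1" using assms by simp
  have mc: "\<mu> * c = 1 - 2 * (real k / real n)"
    using frame_parameter_times_frame_const[OF assms(1,2)] by (simp add: \<mu>_def c_def)
  have "(4 * (real n - 1) + \<mu>\<^sup>2) * c\<^sup>2 = 4 * ((real n - 1) * c\<^sup>2) + (\<mu> * c)\<^sup>2"
    by (simp add: algebra_simps power_mult_distrib)
  also have "(real n - 1) * c\<^sup>2 = real k / real n - (real k / real n)\<^sup>2"
    unfolding c_def using assms by (intro frame_const_square) auto
  also have "4 * (real k / real n - (real k / real n)\<^sup>2) + (\<mu> * c)\<^sup>2 = 1"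
    unfolding mc by (simp add: power2_eq_square algebra_simps)
  finally have "4 * (real n - 1) + \<mu>\<^sup>2 = (1 / c)\<^sup>2"
    using c by (simp add: field_simps)
  then have "sqrt (4 * (real n - 1) + \<mu>\<^sup>2) = 1 / c"
    using c by simp
  then have "\<mu> * real n / (2 * sqrt (4 * (real n - 1) + \<mu>\<^sup>2)) = (\<mu> * c) * real n / 2"
    by simp
  also have "\<dots> = real n / 2 - real k"
    unfolding mc using n by (simp add: field_simps)
  finally show ?thesis by simp
qed

text \<open>
  Solving the idempotency equation of the Gram matrix \<open>(k / n) I + c Q\<close> for \<open>Q\<^sup>2\<close>.
\<close>
lemma signature_matrix_square:
  assumes sig: "signature_matrix n k Q" and il: "i < n" "l < n"
  shows "(\<Sum>j<n. Q $$ (i, j) * Q $$ (j, l))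
     = (if i = l then of_nat n - 1 else 0) + of_real (frame_parameter n k) * Q $$ (i, l)"
proof -
  define a c where "a = complex_of_real (real k / real n)" and "c = complex_of_real (frame_const n k)"
  from sig have k: "1 \<le> k" "k < n" and Q: "Q \<in> carrier_mat n n" and Q0: "\<forall>i<n. Q $$ (i, i) = 0"
    by (auto simp: signature_matrix_def)
  from sig obtain f where pf: "parseval_frame n k f"
    and gram: "gram_mat n f = a \<cdot>\<^sub>m 1\<^sub>m n + c \<cdot>\<^sub>m Q"
    unfolding signature_matrix_def equiangular_frame_def a_def c_def by blast
  have entry: "gram_mat n f $$ (i, j) = (if i = j then a else 0) + c * Q $$ (i, j)"
    if "i < n" "j < n" for i j
    using that Q unfolding gram by auto
  have "(\<Sum>j<n. ((if i = j then a else 0) + c * Q $$ (i, j)) * ((if j = l then a else 0) + c * Q $$ (j, l)))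
      = (if i = l then a else 0) + c * Q $$ (i, l)"
    using gram_mat_idempotent[OF pf il] il by (simp add: entry)
  then have idem: "(if i = l then a\<^sup>2 else 0) + 2 * a * c * Q $$ (i, l)
      + c\<^sup>2 * (\<Sum>j<n. Q $$ (i, j) * Q $$ (j, l)) = (if i = l then a else 0) + c * Q $$ (i, l)"
    using sum_scaled_shift_square[OF il, of a c "\<lambda>i j. Q $$ (i, j)"] by simp
  have "(of_nat n - 1) * c\<^sup>2 = complex_of_real ((real n - 1) * (frame_const n k)\<^sup>2)"
    by (simp add: c_def)
  also have "\<dots> = a - a\<^sup>2"
    using k by (subst frame_const_square) (auto simp: a_def)
  finally have ac: "(of_nat n - 1) * c\<^sup>2 = a - a\<^sup>2" .
  have "of_real (frame_parameter n k) * c = complex_of_real (frame_parameter n k * frame_const n k)"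
    by (simp add: c_def)
  also have "\<dots> = 1 - 2 * a"
    using k by (subst frame_parameter_times_frame_const) (auto simp: a_def)
  finally have mc: "of_real (frame_parameter n k) * c = 1 - 2 * a" .
  have c0: "c\<^sup>2 \<noteq> 0" using frame_const_pos[OF k] by (simp add: c_def)
  have "c\<^sup>2 * (\<Sum>j<n. Q $$ (i, j) * Q $$ (j, l))
      = (if i = l then a - a\<^sup>2 else 0) + (1 - 2 * a) * c * Q $$ (i, l)"
    using idem by (auto simp: algebra_simps)
  also have "\<dots> = c\<^sup>2 * ((if i = l then of_nat n - 1 else 0)
      + of_real (frame_parameter n k) * Q $$ (i, l))"
    unfolding ac[symmetric] mc[symmetric] by (simp add: algebra_simps power2_eq_square)
  finally show ?thesis using c0 by simp
qed

section \<open>Projections are Gram matrices of Parseval frames\<close>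

text \<open>
  The spectral theorem for orthogonal projections, by peeling off one dimension at a time. If \<open>p\<close> is
  not zero, then some diagonal entry \<open>d\<close> is positive, because a diagonal entry is the squared norm of
  its row. The corresponding column divided by \<open>sqrt d\<close> is a unit vector \<open>v\<close> fixed by \<open>p\<close>, hence
  \<open>p - v v\<^sup>*\<close> is again a projection, it annihilates \<open>v\<close>, and its trace is smaller by \<open>1\<close>. As traces
  of projections are nonnegative, this stops.
\<close>
lemma hermitian_idempotent_factorization:
  fixes p :: "nat \<Rightarrow> nat \<Rightarrow> complex"
  assumes herm: "\<And>i j. i < n \<Longrightarrow> j < n \<Longrightarrow> p j i = cnj (p i j)"
    and idem: "\<And>i l. i < n \<Longrightarrow> l < n \<Longrightarrow> (\<Sum>j<n. p i j * p j l) = p i l"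
  shows "\<exists>(k::nat) u. (\<forall>i<n. \<forall>j<n. p i j = (\<Sum>l<k. u l i * cnj (u l j))) \<and>
    (\<forall>l<k. \<forall>m<k. (\<Sum>i<n. u l i * cnj (u m i)) = (if l = m then 1 else 0))"
proof -
  have *: "\<exists>k u. (\<forall>i<n. \<forall>j<n. p i j = (\<Sum>l<k::nat. u l i * cnj (u l j))) \<and>
      (\<forall>l<k. \<forall>m<k. (\<Sum>i<n. u l i * cnj (u m i)) = (if l = m then 1 else 0))"
    if "Re (\<Sum>i<n. p i i) < real N" for N
    using that herm idem
  proof (induction N arbitrary: p)
    case (Suc N p)
    note herm = Suc.prems(2) and idem = Suc.prems(3)
    have diag: "p i i = of_real (\<Sum>j<n. (cmod (p i j))\<^sup>2)" if "i < n" for i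
    proof -
      have "p i i = (\<Sum>j<n. p i j * p j i)" using idem that by simp
      also have "\<dots> = (\<Sum>j<n. of_real ((cmod (p i j))\<^sup>2))"
        using that by (intro sum.cong refl) (simp add: herm[of i] complex_norm_square flip: of_real_power)
      finally show ?thesis by simp
    qed
    show ?case
    proof (cases "\<forall>i<n. p i i = 0")
      case True
      have "p i j = 0" if "i < n" "j < n" for i j
      proof -
        have "complex_of_real (\<Sum>j<n. (cmod (p i j))\<^sup>2) = 0"
          using diag[OF that(1)] True that by metis
        then have "(\<Sum>j<n. (cmod (p i j))\<^sup>2) = 0" by (simp only: of_real_eq_0_iff)
        then have "\<forall>j\<in>{..<n}. (cmod (p i j))\<^sup>2 = 0"
          by (subst (asm) sum_nonneg_eq_0_iff) auto
        then show ?thesis using that by simp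
      qed
      then show ?thesis by (intro exI[of _ 0]) auto
    next
      case False
      then obtain i0 where i0: "i0 < n" "p i0 i0 \<noteq> 0" by blast
      define d where "d = (\<Sum>j<n. (cmod (p i0 j))\<^sup>2)"
      have d: "p i0 i0 = of_real d" using diag i0 by (simp add: d_def)
      have "d \<ge> 0" by (simp add: d_def sum_nonneg)
      with i0 d have d0: "d > 0" by (cases "d = 0") auto
      define v where "v i = p i i0 / of_real (sqrt d)" for i
      have sq: "complex_of_real (sqrt d) * of_real (sqrt d) = of_real d"
        using d0 by (simp flip: of_real_mult)
      have vv: "v i * cnj (v j) = p i i0 * p i0 j / of_real d" if "i < n" "j < n" for i j
        using that herm[of j i0] i0 by (simp add: v_def sq)
      have pv: "(\<Sum>j<n. p i j * v j) = v i" if "i < n" for i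
        using idem[OF that i0(1)] by (simp add: v_def flip: sum_divide_distrib)
      have vp: "(\<Sum>j<n. cnj (v j) * p j i) = cnj (v i)" if "i < n" for i
      proof -
        have "(\<Sum>j<n. cnj (v j) * p j i) = (\<Sum>j<n. cnj (p i j * v j))"
          using that by (intro sum.cong refl) (simp add: herm[of i])
        then show ?thesis using arg_cong[OF pv[OF that], of cnj] by simp
      qed
      have norm: "(\<Sum>i<n. v i * cnj (v i)) = 1"
      proof -
        have "(\<Sum>i<n. v i * cnj (v i)) = (\<Sum>i<n. p i0 i * p i i0) / of_real d"
          unfolding sum_divide_distrib by (intro sum.cong refl) (simp add: vv mult.commute)
        then show ?thesis using idem[OF i0(1) i0(1)] d d0 by simp
      qed
      define p' where "p' i j = p i j - v i * cnj (v j)" for i j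
      have "\<exists>k u. (\<forall>i<n. \<forall>j<n. p' i j = (\<Sum>l<k::nat. u l i * cnj (u l j))) \<and>
        (\<forall>l<k. \<forall>m<k. (\<Sum>i<n. u l i * cnj (u m i)) = (if l = m then 1 else 0))"
      proof (rule Suc.IH)
        show "Re (\<Sum>i<n. p' i i) < real N"
          using Suc.prems(1) norm unfolding p'_def sum_subtractf by simp
        show "p' j i = cnj (p' i j)" if "i < n" "j < n" for i j
          using herm[OF that] by (simp add: p'_def)
        show "(\<Sum>j<n. p' i j * p' j l) = p' i l" if "i < n" "l < n" for i l
        proof -
          have "(\<Sum>j<n. p' i j * p' j l) = (\<Sum>j<n. p i j * p j l) - (\<Sum>j<n. p i j * v j) * cnj (v l)
            - v i * (\<Sum>j<n. cnj (v j) * p j l) + v i * (\<Sum>j<n. v j * cnj (v j)) * cnj (v l)"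
            unfolding sum_distrib_left sum_distrib_right sum_subtractf[symmetric] sum.distrib[symmetric]
            by (intro sum.cong refl) (simp add: p'_def algebra_simps)
          then show ?thesis using that by (simp add: idem pv vp norm p'_def)
        qed
      qed
      then obtain k :: nat and u :: "nat \<Rightarrow> nat \<Rightarrow> complex" where
        p'u: "\<And>i j. i < n \<Longrightarrow> j < n \<Longrightarrow> p' i j = (\<Sum>l<k. u l i * cnj (u l j))"
        and orth: "\<And>l m. l < k \<Longrightarrow> m < k \<Longrightarrow> (\<Sum>i<n. u l i * cnj (u m i)) = (if l = m then 1 else 0)"
        by blast
      (* The remaining projection sends v to 0; pairing the expansion of this image with u m
         isolates the coefficient w m. *)
      have vu: "(\<Sum>i<n. u m i * cnj (v i)) = 0" if "m < k" for m
      proof -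
        define w where "w l = (\<Sum>j<n. cnj (u l j) * v j)" for l
        have p'v: "(\<Sum>l<k. u l i * w l) = 0" if "i < n" for i
        proof -
          have "(\<Sum>l<k. u l i * w l) = (\<Sum>j<n. p' i j * v j)"
            using that unfolding w_def sum_distrib_left
            by (subst sum.swap) (simp add: p'u sum_distrib_left sum_distrib_right mult_ac)
          also have "\<dots> = (\<Sum>j<n. p i j * v j) - v i * (\<Sum>j<n. v j * cnj (v j))"
            unfolding sum_distrib_left sum_subtractf[symmetric]
            by (intro sum.cong refl) (simp add: p'_def algebra_simps)
          finally show ?thesis using that by (simp add: pv norm)
        qed
        have "w m = (\<Sum>l<k. if l = m then w l else 0)" using that by simp
        also have "\<dots> = (\<Sum>l<k. (\<Sum>i<n. u l i * cnj (u m i)) * w l)"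
          using that by (intro sum.cong refl) (simp add: orth)
        also have "\<dots> = (\<Sum>i<n. cnj (u m i) * (\<Sum>l<k. u l i * w l))"
          unfolding sum_distrib_left sum_distrib_right
          by (subst sum.swap) (simp add: mult_ac)
        finally have "w m = 0" by (simp add: p'v)
        moreover have "(\<Sum>i<n. u m i * cnj (v i)) = cnj (w m)" by (simp add: w_def)
        ultimately show ?thesis by simp
      qed
      then have uv: "(\<Sum>i<n. v i * cnj (u m i)) = 0" if "m < k" for m
      proof -
        have "(\<Sum>i<n. v i * cnj (u m i)) = cnj (\<Sum>i<n. u m i * cnj (v i))"
          by (simp add: mult.commute)
        then show ?thesis by (simp add: vu[OF that])
      qed
      show ?thesis
      proof (intro exI[of _ "Suc k"] exI[of _ "u(k := v)"] conjI allI impI)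
        show "p i j = (\<Sum>l<Suc k. (u(k := v)) l i * cnj ((u(k := v)) l j))" if "i < n" "j < n" for i j
          using p'u[OF that] by (simp add: p'_def algebra_simps)
        show "(\<Sum>i<n. (u(k := v)) l i * cnj ((u(k := v)) m i)) = (if l = m then 1 else 0)"
          if "l < Suc k" "m < Suc k" for l m
          using that by (auto simp: less_Suc_eq orth uv vu norm)
      qed
    qed
  next
    case (0 p)
    have "Re (p i i) \<ge> 0" if "i < n" for i
    proof -
      have "Re (p i i) = (\<Sum>j<n. Re (p i j * p j i))"
        using arg_cong[OF "0.prems"(3)[OF that that], of Re] by simp
      also have "\<dots> \<ge> 0"
        using that "0.prems"(2)[of i] by (intro sum_nonneg) (simp add: complex_mult_cnj)
      finally show ?thesis .
    qed
    then have "Re (\<Sum>i<n. p i i) \<ge> 0" by (auto intro!: sum_nonneg)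
    with "0.prems"(1) show ?case by simp
  qed
  obtain N where "Re (\<Sum>i<n. p i i) < real N" using reals_Archimedean2 by blast
  then show ?thesis by (rule *)
qed

text \<open>
  The quadratic equation makes \<open>(Q - \<rho> I) / r\<close> a projection, where \<open>\<rho>\<close> is the smaller root of
  \<open>x\<^sup>2 - \<mu> x - (n - 1)\<close> and \<open>r\<close> is the distance of the two roots. The rows of its
  factorization form the frame. Its dimension \<open>k\<close> is the number of factors, thus the trace \<open>n a\<close>, where \<open>a\<close> is
  the common diagonal entry; this also forces the factor of \<open>Q\<close> to be \<open>frame_const n k\<close>.
\<close>
lemma signature_matrix_if_square:
  assumes Q: "Q \<in> carrier_mat n n" and adj: "mat_adjoint Q = Q"
    and Q0: "\<And>i. i < n \<Longrightarrow> Q $$ (i, i) = 0"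
    and Q1: "\<And>i j. i < n \<Longrightarrow> j < n \<Longrightarrow> i \<noteq> j \<Longrightarrow> cmod (Q $$ (i, j)) = 1"
    and n: "n \<ge> 2"
    and sq: "\<And>i l. i < n \<Longrightarrow> l < n \<Longrightarrow> (\<Sum>j<n. Q $$ (i, j) * Q $$ (j, l))
        = (if i = l then of_nat n - 1 else 0) + complex_of_real \<mu> * Q $$ (i, l)"
  shows "\<exists>k. signature_matrix n k Q"
proof -
  define r where "r = sqrt (\<mu>\<^sup>2 + 4 * (real n - 1))"
  have r0: "r > 0" using n unfolding r_def by (intro real_sqrt_gt_zero add_nonneg_pos) auto
  have r2: "r\<^sup>2 = \<mu>\<^sup>2 + 4 * (real n - 1)" using n by (simp add: r_def)
  define c a where "c = 1 / r" and "a = (1 - \<mu> / r) / 2"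
  have c0: "c > 0" using r0 by (simp add: c_def)
  have lin: "2 * a * c + c\<^sup>2 * \<mu> = c"
    using r0 by (simp add: a_def c_def power2_eq_square field_simps)
  have a_eq: "a = (1 - \<mu> * c) / 2" by (simp add: a_def c_def)
  have "a - a\<^sup>2 = (1 - \<mu>\<^sup>2 * c\<^sup>2) / 4"
    by (simp add: a_eq power2_eq_square field_simps)
  also have "1 = r\<^sup>2 * c\<^sup>2" using r0 by (simp add: c_def power_divide)
  also have "(r\<^sup>2 * c\<^sup>2 - \<mu>\<^sup>2 * c\<^sup>2) / 4 = (real n - 1) * c\<^sup>2"
    by (simp add: r2 field_simps)
  finally have quad: "a - a\<^sup>2 = (real n - 1) * c\<^sup>2" .
  (* a lies strictly between 0 and 1, which will give 1 <= k < n. *)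
  have "a * (1 - a) = (real n - 1) * c\<^sup>2"
    using quad by (simp add: right_diff_distrib power2_eq_square)
  also have "\<dots> > 0" using n c0 by simp
  finally have a01: "0 < a" "a < 1" by (auto simp: zero_less_mult_iff)
  define p where "p i j = (if i = j then complex_of_real a else 0) + complex_of_real c * Q $$ (i, j)" for i j
  have herm: "p j i = cnj (p i j)" if "i < n" "j < n" for i j
  proof -
    have "Q $$ (j, i) = cnj (Q $$ (i, j))"
      using adj that mat_adjoint_eq_self_iff[OF Q] by blast
    then show ?thesis by (simp add: p_def)
  qed
  have idem: "(\<Sum>j<n. p i j * p j l) = p i l" if "i < n" "l < n" for i l
  proof -
    have "(\<Sum>j<n. p i j * p j l) = (if i = l then of_real (a\<^sup>2 + (real n - 1) * c\<^sup>2) else 0)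
        + of_real (2 * a * c + c\<^sup>2 * \<mu>) * Q $$ (i, l)"
      unfolding p_def sum_scaled_shift_square[OF that, of "complex_of_real a" "complex_of_real c" "\<lambda>i j. Q $$ (i, j)"]
        sq[OF that]
      by (simp add: algebra_simps)
    then show ?thesis unfolding lin quad[symmetric] by (simp add: p_def)
  qed
  obtain k :: nat and u :: "nat \<Rightarrow> nat \<Rightarrow> complex" where
    pu: "\<And>i j. i < n \<Longrightarrow> j < n \<Longrightarrow> p i j = (\<Sum>l<k. u l i * cnj (u l j))"
    and orth: "\<And>l m. l < k \<Longrightarrow> m < k \<Longrightarrow> (\<Sum>i<n. u l i * cnj (u m i)) = (if l = m then 1 else 0)"
    using hermitian_idempotent_factorization[of n p, OF herm idem] by blast
  have "complex_of_real (real n * a) = (\<Sum>i<n. p i i)"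
    by (simp add: p_def Q0)
  also have "\<dots> = (\<Sum>l<k. \<Sum>i<n. u l i * cnj (u l i))"
    by (simp add: pu) (rule sum.swap)
  also have "\<dots> = of_nat k" by (simp add: orth)
  finally have "real n * a = real k"
    by (metis of_real_eq_iff of_real_of_nat_eq)
  then have a: "a = real k / real n" using n by (simp add: field_simps)
  have k: "1 \<le> k" "k < n"
    using a01 n unfolding a by (auto simp: field_simps)
  have "(frame_const n k)\<^sup>2 = c\<^sup>2"
    using frame_const_square[OF k(2) n] quad n by (simp add: a)
  then have c: "c = frame_const n k"
    using c0 frame_const_pos[OF k] by (simp add: power2_eq_iff)
  (* The entries are conjugated because entry (i, j) of a Gram matrix is the product of f j with
     f i, in this order. *)
  define f where "f j = vec k (\<lambda>l. cnj (u l j))" for j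
  have f: "f j \<in> carrier_vec k" for j by (simp add: f_def)
  have gram: "f j \<bullet>c f i = p i j" if "i < n" "j < n" for i j
    unfolding cscalar_prod_conv_sum[OF f] using that by (simp add: f_def pu mult.commute)
  have "parseval_frame n k f"
    unfolding parseval_frame_def
  proof (intro conjI allI impI ballI f)
    fix x :: "complex vec" assume x: "x \<in> carrier_vec k"
    have "complex_of_real (\<Sum>j<n. (cmod (x \<bullet>c f j))\<^sup>2) = (\<Sum>j<n. (x \<bullet>c f j) * cnj (x \<bullet>c f j))"
      by (simp add: complex_norm_square flip: of_real_power)
    also have "\<dots> = (\<Sum>j<n. \<Sum>l<k. \<Sum>m<k. (x $ l * cnj (x $ m)) * (u l j * cnj (u m j)))"
      unfolding cscalar_prod_conv_sum[OF f] cnj_sum sum_product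
      by (intro sum.cong refl) (simp add: f_def mult_ac)
    also have "\<dots> = (\<Sum>l<k. \<Sum>m<k. (x $ l * cnj (x $ m)) * (\<Sum>j<n. u l j * cnj (u m j)))"
      unfolding sum_distrib_left
      by (rule trans[OF sum.swap sum.cong[OF refl sum.swap]])
    also have "\<dots> = (\<Sum>l<k. x $ l * cnj (x $ l))"
      by (intro sum.cong refl) (simp add: orth if_distrib[of "\<lambda>c. _ * c"] cong: if_cong)
    also have "\<dots> = complex_of_real ((cvec_norm x)\<^sup>2)"
      unfolding cvec_norm_square[OF x] cscalar_prod_conv_sum[OF x] ..
    finally show "(\<Sum>j<n. (cmod (x \<bullet>c f j))\<^sup>2) = (cvec_norm x)\<^sup>2"
      unfolding of_real_eq_iff .
  qed
  moreover have norm_f: "cvec_norm (f i) = sqrt a" if "i < n" for i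
    using gram[OF that that] Q0[OF that] by (simp add: cvec_norm_def p_def)
  have "f i \<noteq> 0\<^sub>v k" if "i < n" for i
    using gram[OF that that] Q0[OF that] a01 by (auto simp: p_def)
  moreover have "cmod (normalized_vec (f i) \<bullet>c normalized_vec (f j)) = c / a"
    if ij: "i < n" "j < n" "i \<noteq> j" for i j
  proof -
    have "normalized_vec (f i) \<bullet>c normalized_vec (f j)
        = of_real (1 / a) * (f i \<bullet>c f j)"
    proof -
      have car: "normalized_vec (f j) \<in> carrier_vec k" by (simp add: normalized_vec_def f)
      show ?thesis
        unfolding cscalar_prod_conv_sum[OF car] cscalar_prod_conv_sum[OF f] sum_distrib_left
        using ij f[of i] f[of j] a01
        by (intro sum.cong refl) (simp add: normalized_vec_def norm_f flip: of_real_mult)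
    qed
    then show ?thesis
      using a01 c0 ij gram[of j i] Q1[of j i] by (simp add: p_def norm_mult norm_divide)
  qed
  ultimately have "equiangular_frame n k f"
    unfolding equiangular_frame_def by blast
  moreover have "gram_mat n f = complex_of_real (real k / real n) \<cdot>\<^sub>m 1\<^sub>m n
      + complex_of_real (frame_const n k) \<cdot>\<^sub>m Q"
    using Q by (intro eq_matI) (auto simp: gram_mat_def gram p_def a c)
  ultimately show ?thesis
    unfolding signature_matrix_def using k Q adj Q0 Q1 by blast
qed

section \<open>Sign functions on a group and their convolution\<close>

definition signed_indicator :: "('a, 'b) monoid_scheme \<Rightarrow> 'a set \<Rightarrow> 'a \<Rightarrow> real" where
  "signed_indicator G A x = (if x = \<one>\<^bsub>G\<^esub> then 0 else if x \<in> A then 1 else - 1)"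

definition sign_convolution :: "('a, 'b) monoid_scheme \<Rightarrow> 'a set \<Rightarrow> 'a \<Rightarrow> real" where
  "sign_convolution G A g =
     (\<Sum>x\<in>carrier G. signed_indicator G A (g \<otimes>\<^bsub>G\<^esub> inv\<^bsub>G\<^esub> x) * signed_indicator G A x)"

context group
begin

lemma sum_left_quotient:
  assumes g: "g \<in> carrier G"
  shows "(\<Sum>x\<in>carrier G. F (g \<otimes> inv x)) = (\<Sum>x\<in>carrier G. F x)"
  using g by (intro sum.reindex_bij_witness[of _ "\<lambda>y. inv y \<otimes> g" "\<lambda>x. g \<otimes> inv x"])
    (auto simp: inv_mult_group m_assoc simp flip: m_assoc[of g])

lemma sum_right_translate:
  assumes g: "g \<in> carrier G"
  shows "(\<Sum>x\<in>carrier G. F (x \<otimes> g)) = (\<Sum>x\<in>carrier G. F x)"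
  using g by (intro sum.reindex_bij_witness[of _ "\<lambda>y. y \<otimes> inv g" "\<lambda>x. x \<otimes> g"]) (auto simp: m_assoc)

lemma num_factorizations_conv_sum:
  assumes "finite (carrier G)" "A \<subseteq> carrier G" "g \<in> carrier G"
  shows "real (num_factorizations G A A g)
    = (\<Sum>x\<in>carrier G. of_bool (g \<otimes> inv x \<in> A) * of_bool (x \<in> A))"
proof -
  have "{(g1, g2). g1 \<in> A \<and> g2 \<in> A \<and> g1 \<otimes> g2 = g}
      = (\<lambda>x. (g \<otimes> inv x, x)) ` {x \<in> carrier G. g \<otimes> inv x \<in> A \<and> x \<in> A}"
    using assms by (auto simp: image_iff m_assoc subset_iff inv_solve_right)
  moreover have "inj_on (\<lambda>x. (g \<otimes> inv x, x)) X" for X by (auto intro: inj_onI)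
  ultimately have "num_factorizations G A A g = card {x \<in> carrier G. g \<otimes> inv x \<in> A \<and> x \<in> A}"
    by (simp add: num_factorizations_def card_image)
  also have "real \<dots> = (\<Sum>x\<in>carrier G. of_bool (g \<otimes> inv x \<in> A \<and> x \<in> A))"
    using assms by (simp add: sum.inter_filter[symmetric] of_bool_def)
  finally show ?thesis by (simp add: of_bool_conj)
qed

text \<open>
  Both factors are expanded as \<open>2 \<alpha> + \<delta> - 1\<close>, with \<open>\<alpha>\<close> the indicator of \<open>A\<close> and \<open>\<delta>\<close> that of
  the identity. The product \<open>\<alpha> (g \<otimes> inv x) \<alpha> x\<close> counts factorizations; each other product has a sum
  that is known from \<open>card A\<close>, from \<open>card (carrier G)\<close>, or from \<open>g \<in> A\<close>.
\<close>
lemma sign_convolution_on_set: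
  assumes fin: "finite (carrier G)" and A: "A \<subseteq> carrier G - {\<one>}" and g: "g \<in> A"
  shows "sign_convolution G A g
    = 4 * real (num_factorizations G A A g) + real (card (carrier G)) + 2 - 4 * real (card A)"
proof -
  let ?q = "\<lambda>x. g \<otimes> inv x"
  define \<alpha> \<delta> :: "'a \<Rightarrow> real" where "\<alpha> x = of_bool (x \<in> A)" and "\<delta> x = of_bool (x = \<one>)" for x
  have gc: "g \<in> carrier G" "g \<noteq> \<one>" using A g by auto
  have sgn: "signed_indicator G A x = 2 * \<alpha> x + \<delta> x - 1" for x
    using A by (auto simp: signed_indicator_def \<alpha>_def \<delta>_def)
  have \<alpha>: "(\<Sum>x\<in>carrier G. \<alpha> x) = real (card A)"
  proof -
    have "carrier G \<inter> A = A" using A by auto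
    then show ?thesis using fin by (simp add: \<alpha>_def Int_def)
  qed
  have delta: "(\<Sum>x\<in>carrier G. \<delta> x * F x) = F \<one>" for F
    using fin by (simp add: \<delta>_def of_bool_def if_distribR if_distrib[of "\<lambda>c. c * _"] cong: if_cong)
  have q_delta: "(\<Sum>x\<in>carrier G. \<delta> (?q x) * F x) = F g" for F
  proof -
    have "(\<Sum>x\<in>carrier G. \<delta> (?q x) * F x) = (\<Sum>x\<in>carrier G. \<delta> (?q x) * F (inv (?q x) \<otimes> g))"
      using gc by (intro sum.cong refl) (auto simp: \<delta>_def inv_mult_group m_assoc)
    also have "\<dots> = F g"
      using gc sum_left_quotient[OF gc(1), of "\<lambda>y. \<delta> y * F (inv y \<otimes> g)"]
      by (simp add: delta)
    finally show ?thesis .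
  qed
  have "sign_convolution G A g
      = (\<Sum>x\<in>carrier G. 4 * (\<alpha> (?q x) * \<alpha> x) + 2 * (\<delta> x * \<alpha> (?q x)) + 2 * (\<delta> (?q x) * \<alpha> x)
          + \<delta> (?q x) * \<delta> x - 2 * \<alpha> (?q x) - 2 * \<alpha> x - \<delta> (?q x) * 1 - \<delta> x * 1 + 1)"
    unfolding sign_convolution_def sgn by (intro sum.cong refl) (simp add: algebra_simps)
  also have "\<dots> = 4 * (\<Sum>x\<in>carrier G. \<alpha> (?q x) * \<alpha> x) + 2 * \<alpha> (?q \<one>) + 2 * \<alpha> g + \<delta> g
      - 2 * real (card A) - 2 * real (card A) - 1 - 1 + real (card (carrier G))"
    unfolding sum.distrib sum_subtractf sum_distrib_left[symmetric] delta q_delta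
      sum_left_quotient[OF gc(1)] \<alpha> by simp
  also have "\<dots> = 4 * real (num_factorizations G A A g) + real (card (carrier G)) + 2 - 4 * real (card A)"
    using A gc g by (subst num_factorizations_conv_sum) (auto simp: fin \<alpha>_def \<delta>_def)
  finally show ?thesis .
qed

end

section \<open>The bordered matrix of an inverse closed set\<close>

lemma finsum_module_mat:
  fixes A :: "'c \<Rightarrow> 'd::comm_ring_1 mat"
  assumes "finite F" and "\<And>g. g \<in> F \<Longrightarrow> A g \<in> carrier_mat nr nc"
  shows "finsum (module_mat TYPE('d) nr nc) A F = mat nr nc (\<lambda>(i, j). \<Sum>g\<in>F. A g $$ (i, j))"
proof -
  interpret M: abelian_group "module_mat TYPE('d) nr nc" by (rule abelian_group_mat)
  from assms show ?thesis
  proof (induction F)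
    case empty
    then show ?case by (auto simp: module_mat_simps intro!: eq_matI)
  next
    case (insert g F)
    then have "finsum (module_mat TYPE('d) nr nc) A (insert g F)
        = A g + finsum (module_mat TYPE('d) nr nc) A F"
      by (subst M.finsum_insert) (auto simp: module_mat_simps)
    also have "finsum (module_mat TYPE('d) nr nc) A F = mat nr nc (\<lambda>(i, j). \<Sum>g\<in>F. A g $$ (i, j))"
      using insert.prems by (intro insert.IH) simp
    finally show ?case
      using insert by (auto intro!: eq_matI)
  qed
qed

lemma all_less_Suc_shift: "(\<forall>i<Suc N. P i) \<longleftrightarrow> P 0 \<and> (\<forall>i<N. P (Suc i))"
  by (auto simp: less_Suc_eq_0_disj)

locale inverse_closed_partition = group G for G (structure) +
  fixes e :: "nat \<Rightarrow> 'a" and S T :: "'a set"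
  assumes finite_carrier: "finite (carrier G)"
    and enumeration: "bij_betw e {..<card (carrier G)} (carrier G)"
    and disjoint: "S \<inter> T = {}"
    and partition: "carrier G - {\<one>} = S \<union> T"
    and inv_closed: "set_inv S = S"
begin

abbreviation m :: nat where "m \<equiv> card (carrier G)"

abbreviation \<mu> :: real where "\<mu> \<equiv> real (card S) - real (card T)"

lemma m_pos: "m > 0"
  using finite_carrier by (auto simp: card_gt_0_iff)

lemma subsets: "S \<subseteq> carrier G - {\<one>}" "T \<subseteq> carrier G - {\<one>}" "T = carrier G - {\<one>} - S"
  using partition disjoint by auto

lemma enum_carrier: "i < m \<Longrightarrow> e i \<in> carrier G"
  using enumeration by (auto simp: bij_betw_def)

lemma card_parts: "real m = real (card S) + real (card T) + 1"
proof -
  have "finite S" "finite T" using subsets finite_carrier by (meson finite_Diff finite_subset)+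
  moreover have "carrier G = insert \<one> (S \<union> T)" using partition by auto
  moreover have "\<one> \<notin> S \<union> T" using partition by auto
  ultimately have "m = Suc (card S + card T)" using disjoint by (simp add: card_Un_disjoint)
  then show ?thesis by simp
qed

lemma sum_signed_indicator: "(\<Sum>x\<in>carrier G. signed_indicator G S x) = \<mu>"
proof -
  have fin: "finite S" "finite T" using subsets finite_carrier by (meson finite_Diff finite_subset)+
  have "carrier G = insert \<one> (S \<union> T)" and nin: "\<one> \<notin> S \<union> T" using partition by auto
  then have "(\<Sum>x\<in>carrier G. signed_indicator G S x) = (\<Sum>x\<in>S. signed_indicator G S x) + (\<Sum>x\<in>T. signed_indicator G S x)"
    using fin disjoint by (simp add: sum.union_disjoint signed_indicator_def)
  also have "(\<Sum>x\<in>S. signed_indicator G S x) = (\<Sum>x\<in>S. 1)"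
    using nin by (intro sum.cong) (auto simp: signed_indicator_def)
  also have "(\<Sum>x\<in>T. signed_indicator G S x) = (\<Sum>x\<in>T. - 1)"
    using nin disjoint by (intro sum.cong) (auto simp: signed_indicator_def)
  finally show ?thesis by simp
qed

lemma signed_indicator_inv:
  assumes "x \<in> carrier G"
  shows "signed_indicator G S (inv x) = signed_indicator G S x"
proof -
  have inv_mem: "inv y \<in> S" if "y \<in> S" for y
    using inv_closed that by (auto simp: SET_INV_def)
  have "inv x \<in> S \<longleftrightarrow> x \<in> S"
    using inv_mem[of x] inv_mem[of "inv x"] assms by auto
  then show ?thesis using assms by (simp add: signed_indicator_def inv_eq_1_iff)
qed

lemma sign_convolution_one: "sign_convolution G S \<one> = real m - 1"
proof -
  have "sign_convolution G S \<one> = (\<Sum>x\<in>carrier G. 1 - of_bool (x = \<one>))"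
    unfolding sign_convolution_def
    by (intro sum.cong refl) (simp add: signed_indicator_inv, simp add: signed_indicator_def)
  also have "\<dots> = real m - 1"
    using finite_carrier by (simp add: sum_subtractf of_bool_def)
  finally show ?thesis .
qed

lemma sign_convolution_on_S:
  assumes "g \<in> S"
  shows "1 + sign_convolution G S g = \<mu> * signed_indicator G S g
    \<longleftrightarrow> real (num_factorizations G S S g) = (real (m + 1) + 3 * \<mu> - 6) / 4"
  using assms subsets(1,2) card_parts
  by (auto simp: sign_convolution_on_set[OF finite_carrier] signed_indicator_def field_simps)

text \<open>
  Exchanging \<open>S\<close> and \<open>T\<close> negates \<open>signed_indicator\<close>, so the convolution stays the same while \<open>\<mu>\<close>
  changes its sign.
\<close>
lemma sign_convolution_on_T:
  assumes "h \<in> T"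
  shows "1 + sign_convolution G S h = \<mu> * signed_indicator G S h
    \<longleftrightarrow> real (num_factorizations G T T h) = (real (m + 1) - 3 * \<mu> - 6) / 4"
proof -
  have opp: "signed_indicator G S x = - signed_indicator G T x" if "x \<in> carrier G" for x
    using that partition disjoint by (auto simp: signed_indicator_def)
  have "sign_convolution G S h = sign_convolution G T h"
    using assms subsets(1,2) unfolding sign_convolution_def
    by (intro sum.cong refl) (auto simp: opp)
  then show ?thesis
    using assms subsets(1,2) disjoint card_parts
    by (auto simp: sign_convolution_on_set[OF finite_carrier] signed_indicator_def field_simps)
qed

lemma Q_mat_carrier: "Q_mat G e S \<in> carrier_mat m m"
  and Q_mat_index: "i < m \<Longrightarrow> j < m \<Longrightarrow> Q_mat G e S $$ (i, j) = of_real (signed_indicator G S (e i \<otimes> inv e j))"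
proof -
  have fin: "finite S" "finite T" using subsets finite_carrier by (meson finite_Diff finite_subset)+
  have car: "left_regular G e g \<in> carrier_mat m m" for g by (simp add: left_regular_def)
  have Q: "Q_mat G e S = mat m m (\<lambda>(i, j). \<Sum>g\<in>S. left_regular G e g $$ (i, j))
      - mat m m (\<lambda>(i, j). \<Sum>g\<in>T. left_regular G e g $$ (i, j))"
    using fin by (simp add: Q_mat_def Let_def finsum_module_mat car flip: subsets(3))
  show "Q_mat G e S \<in> carrier_mat m m" unfolding Q by (intro minus_carrier_mat) simp
  assume ij: "i < m" "j < m"
  have count: "(\<Sum>g\<in>A. left_regular G e g $$ (i, j)) = of_bool (e i \<otimes> inv e j \<in> A)"
    if "finite A" "A \<subseteq> carrier G" for A
  proof -
    have "(\<Sum>g\<in>A. left_regular G e g $$ (i, j)) = (\<Sum>g\<in>A. if g = e i \<otimes> inv e j then 1 else 0)"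
      using ij that enum_carrier[of i] enum_carrier[of j]
      by (intro sum.cong refl) (auto simp: left_regular_def m_assoc inv_solve_right)
    then show ?thesis using that by simp
  qed
  have "e i \<otimes> inv e j \<in> carrier G" using ij enum_carrier by simp
  then consider "e i \<otimes> inv e j = \<one>" | "e i \<otimes> inv e j \<in> S" | "e i \<otimes> inv e j \<in> T"
    using partition by auto
  moreover have "Q_mat G e S $$ (i, j)
      = of_bool (e i \<otimes> inv e j \<in> S) - of_bool (e i \<otimes> inv e j \<in> T)"
    using ij count[OF fin(1)] count[OF fin(2)] subsets(1,2) by (simp add: Q subset_Diff_insert)
  moreover have "\<one> \<notin> S" "\<one> \<notin> T" using subsets(1,2) by auto
  ultimately show "Q_mat G e S $$ (i, j) = of_real (signed_indicator G S (e i \<otimes> inv e j))"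
    using disjoint by cases (auto simp: signed_indicator_def)
qed

lemma Q_mat_row_sum:
  assumes "i < m"
  shows "(\<Sum>j<m. Q_mat G e S $$ (i, j)) = of_real \<mu>"
proof -
  have "(\<Sum>j<m. Q_mat G e S $$ (i, j)) = of_real (\<Sum>j<m. signed_indicator G S (e i \<otimes> inv e j))"
    using assms by (simp add: Q_mat_index)
  also have "(\<Sum>j<m. signed_indicator G S (e i \<otimes> inv e j)) = (\<Sum>x\<in>carrier G. signed_indicator G S (e i \<otimes> inv x))"
    by (rule sum.reindex_bij_betw[OF enumeration])
  also have "\<dots> = \<mu>"
    unfolding sum_left_quotient[OF enum_carrier[OF assms]] by (rule sum_signed_indicator)
  finally show ?thesis .
qed

lemma Q_mat_symmetric:
  assumes "i < m" "j < m"
  shows "Q_mat G e S $$ (j, i) = Q_mat G e S $$ (i, j)"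
  using assms signed_indicator_inv[of "e i \<otimes> inv e j"] by (simp add: Q_mat_index enum_carrier inv_mult_group)

text \<open>
  The substitution \<open>x \<mapsto> x \<otimes> e l\<close> turns the matrix product into a convolution.
\<close>
lemma Q_mat_square:
  assumes "i < m" "l < m"
  shows "(\<Sum>j<m. Q_mat G e S $$ (i, j) * Q_mat G e S $$ (j, l))
    = of_real (sign_convolution G S (e i \<otimes> inv e l))"
proof -
  note c = enum_carrier[OF assms(1)] enum_carrier[OF assms(2)]
  have "(\<Sum>j<m. Q_mat G e S $$ (i, j) * Q_mat G e S $$ (j, l))
      = of_real (\<Sum>j<m. signed_indicator G S (e i \<otimes> inv e j) * signed_indicator G S (e j \<otimes> inv e l))"
    using assms by (simp add: Q_mat_index)
  also have "(\<Sum>j<m. signed_indicator G S (e i \<otimes> inv e j) * signed_indicator G S (e j \<otimes> inv e l))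
      = (\<Sum>x\<in>carrier G. signed_indicator G S (e i \<otimes> inv x) * signed_indicator G S (x \<otimes> inv e l))"
    by (rule sum.reindex_bij_betw[OF enumeration])
  also have "\<dots> = (\<Sum>x\<in>carrier G. signed_indicator G S (e i \<otimes> inv (x \<otimes> e l)) * signed_indicator G S (x \<otimes> e l \<otimes> inv e l))"
    by (rule sum_right_translate[OF c(2), symmetric])
  also have "\<dots> = sign_convolution G S (e i \<otimes> inv e l)"
    unfolding sign_convolution_def using c
    by (intro sum.cong refl) (simp add: inv_mult_group m_assoc)
  finally show ?thesis .
qed

lemma Q_tilde_carrier: "Q_tilde_mat G e S \<in> carrier_mat (m + 1) (m + 1)"
  and Q_tilde_index:
    "Q_tilde_mat G e S $$ (0, 0) = 0"
    "j < m \<Longrightarrow> Q_tilde_mat G e S $$ (0, Suc j) = 1"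
    "i < m \<Longrightarrow> Q_tilde_mat G e S $$ (Suc i, 0) = 1"
    "i < m \<Longrightarrow> j < m \<Longrightarrow> Q_tilde_mat G e S $$ (Suc i, Suc j) = Q_mat G e S $$ (i, j)"
  using Q_mat_carrier by (auto simp: Q_tilde_mat_def Let_def)

lemma enum_quotient_eq_one_iff:
  assumes "i < m" "l < m"
  shows "e i \<otimes> inv e l = \<one> \<longleftrightarrow> i = l"
proof -
  have "e i \<otimes> inv e l = \<one> \<longleftrightarrow> e i = e l"
    using assms enum_carrier[of i] enum_carrier[of l] inv_solve_right[of \<one> "e i" "e l"] by auto
  also have "\<dots> \<longleftrightarrow> i = l"
    using assms bij_betw_imp_inj_on[OF enumeration] by (auto simp: inj_on_def)
  finally show ?thesis .
qed

text \<open>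
  The border contributes \<open>1\<close> to each entry of the lower right block of the square. In that block the
  diagonal holds for any \<open>\<nu>\<close>, and so does the upper left entry; the remaining border entries are
  row and column sums of \<open>Q\<close>, and they force \<open>\<nu> = \<mu>\<close>.
\<close>
lemma Q_tilde_square_iff:
  "(\<forall>i<m + 1. \<forall>l<m + 1. (\<Sum>j<m + 1. Q_tilde_mat G e S $$ (i, j) * Q_tilde_mat G e S $$ (j, l))
      = (if i = l then of_nat (m + 1) - 1 else 0) + complex_of_real \<nu> * Q_tilde_mat G e S $$ (i, l))
    \<longleftrightarrow> \<nu> = \<mu> \<and> (\<forall>g\<in>carrier G - {\<one>}. 1 + sign_convolution G S g = \<nu> * signed_indicator G S g)"
  (is "?L \<longleftrightarrow> ?R")
proof -
  have col: "(\<Sum>j<m. Q_mat G e S $$ (j, l)) = of_real \<mu>" if "l < m" for l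
  proof -
    have "(\<Sum>j<m. Q_mat G e S $$ (j, l)) = (\<Sum>j<m. Q_mat G e S $$ (l, j))"
      using that by (intro sum.cong refl) (simp add: Q_mat_symmetric[of l])
    then show ?thesis using Q_mat_row_sum[OF that] by simp
  qed
  have inhabited: "\<exists>i. i < m" using m_pos by blast
  have diagonal: "1 + complex_of_real (sign_convolution G S (e i \<otimes> inv e i))
      = of_nat m + of_real \<nu> * Q_mat G e S $$ (i, i)" if "i < m" for i
    using enum_quotient_eq_one_iff[OF that that] that
    by (simp add: sign_convolution_one signed_indicator_def Q_mat_index)
  have off_diagonal: "1 + complex_of_real (sign_convolution G S (e i \<otimes> inv e l))
      = of_real \<nu> * Q_mat G e S $$ (i, l)
    \<longleftrightarrow> 1 + sign_convolution G S (e i \<otimes> inv e l) = \<nu> * signed_indicator G S (e i \<otimes> inv e l)"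
    if "i < m" "l < m" for i l
    using that of_real_eq_iff[of "1 + sign_convolution G S (e i \<otimes> inv e l)"
        "\<nu> * signed_indicator G S (e i \<otimes> inv e l)", where 'a = complex]
    by (simp add: Q_mat_index)
  have "?L \<longleftrightarrow> complex_of_real \<mu> = of_real \<nu> \<and>
      (\<forall>i<m. \<forall>l<m. i \<noteq> l \<longrightarrow> 1 + sign_convolution G S (e i \<otimes> inv e l) = \<nu> * signed_indicator G S (e i \<otimes> inv e l))"
    unfolding add_0_right Suc_eq_plus1[symmetric] all_less_Suc_shift sum.lessThan_Suc_shift
    by (simp add: Q_tilde_index Q_mat_row_sum col Q_mat_square diagonal off_diagonal inhabited imp_conjR all_conj_distrib
        del: of_real_diff) blast
  also have "(\<forall>i<m. \<forall>l<m. i \<noteq> l \<longrightarrow> 1 + sign_convolution G S (e i \<otimes> inv e l) = \<nu> * signed_indicator G S (e i \<otimes> inv e l))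
      \<longleftrightarrow> (\<forall>g\<in>carrier G - {\<one>}. 1 + sign_convolution G S g = \<nu> * signed_indicator G S g)" (is "?A \<longleftrightarrow> ?B")
  proof
    assume A: ?A
    show ?B
    proof
      fix g assume g: "g \<in> carrier G - {\<one>}"
      have "g \<in> e ` {..<m}" "\<one> \<in> e ` {..<m}"
        using g enumeration by (simp_all add: bij_betw_def)
      (* Every group element is a quotient of two distinct enumerated ones, namely of itself and
         the identity. *)
      then obtain i l where i: "i < m" "g = e i" and l: "l < m" "\<one> = e l" by blast
      have "i \<noteq> l" using g by (metis i(2) l(2) DiffD2 singletonI)
      then have "1 + sign_convolution G S (g \<otimes> inv \<one>) = \<nu> * signed_indicator G S (g \<otimes> inv \<one>)"
        unfolding i(2) l(2) using A i(1) l(1) by blast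
      then show "1 + sign_convolution G S g = \<nu> * signed_indicator G S g"
        using g by simp
    qed
  next
    assume ?B
    then show ?A using enum_quotient_eq_one_iff enum_carrier by auto
  qed
  finally show ?thesis by (auto simp only: of_real_eq_iff)
qed

lemma Q_tilde_adjoint: "mat_adjoint (Q_tilde_mat G e S) = Q_tilde_mat G e S"
  unfolding mat_adjoint_eq_self_iff[OF Q_tilde_carrier] Suc_eq_plus1[symmetric] all_less_Suc_shift
  by (simp add: Q_tilde_index Q_mat_index)
    (metis Q_mat_index Q_mat_symmetric of_real_eq_iff)

lemma Q_tilde_diagonal: "i < m + 1 \<Longrightarrow> Q_tilde_mat G e S $$ (i, i) = 0"
  by (cases i) (auto simp: Q_tilde_index Q_mat_index enum_carrier signed_indicator_def)

lemma Q_tilde_cmod: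
  assumes "i < m + 1" "j < m + 1" "i \<noteq> j"
  shows "cmod (Q_tilde_mat G e S $$ (i, j)) = 1"
  using assms
  by (cases i; cases j)
    (auto simp: Q_tilde_index Q_mat_index signed_indicator_def enum_quotient_eq_one_iff)

section \<open>Quasi-signature sets and factorization counts\<close>

lemma quasi_signature_set_imp:
  assumes "quasi_signature_set G e S (m + 1) k"
  shows "1 \<le> k \<and> k < m + 1 \<and> frame_parameter (m + 1) k = \<mu> \<and>
    (\<forall>g\<in>carrier G - {\<one>}. 1 + sign_convolution G S g = \<mu> * signed_indicator G S g)"
proof -
  have sig: "signature_matrix (m + 1) k (Q_tilde_mat G e S)"
    using assms by (simp add: quasi_signature_set_def)
  then have "1 \<le> k" "k < m + 1" by (simp_all add: signature_matrix_def)
  moreover have "frame_parameter (m + 1) k = \<mu> \<and>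
    (\<forall>g\<in>carrier G - {\<one>}. 1 + sign_convolution G S g
      = frame_parameter (m + 1) k * signed_indicator G S g)"
    using signature_matrix_square[OF sig] by (subst Q_tilde_square_iff[symmetric]) blast
  ultimately show ?thesis by simp
qed

lemma quasi_signature_set_exists:
  assumes "\<forall>g\<in>carrier G - {\<one>}. 1 + sign_convolution G S g = \<mu> * signed_indicator G S g"
  shows "\<exists>k. quasi_signature_set G e S (m + 1) k"
proof -
  have "\<exists>k. signature_matrix (m + 1) k (Q_tilde_mat G e S)"
  proof (rule signature_matrix_if_square[OF Q_tilde_carrier Q_tilde_adjoint Q_tilde_diagonal Q_tilde_cmod])
    show "2 \<le> m + 1" using m_pos by simp
    show "(\<Sum>j<m + 1. Q_tilde_mat G e S $$ (i, j) * Q_tilde_mat G e S $$ (j, l))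
      = (if i = l then of_nat (m + 1) - 1 else 0) + complex_of_real \<mu> * Q_tilde_mat G e S $$ (i, l)"
      if "i < m + 1" "l < m + 1" for i l
      using Q_tilde_square_iff[of \<mu>] assms that by blast
  qed
  then show ?thesis using subsets(1) by (simp add: quasi_signature_set_def)
qed

lemma convolution_equation_iff_counts:
  "(\<forall>g\<in>carrier G - {\<one>}. 1 + sign_convolution G S g = \<mu> * signed_indicator G S g) \<longleftrightarrow>
    (\<forall>g\<in>S. real (num_factorizations G S S g) = (real (m + 1) + 3 * \<mu> - 6) / 4) \<and>
    (\<forall>h\<in>T. real (num_factorizations G T T h) = (real (m + 1) - 3 * \<mu> - 6) / 4)"
  unfolding partition ball_Un
  by (intro arg_cong2[of _ _ _ _ "(\<and>)"] ball_cong refl sign_convolution_on_S sign_convolution_on_T)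

end

theorem theorem5p6:
  fixes G :: "('a, 'b) monoid_scheme" and e :: "nat \<Rightarrow> 'a"
    and S T :: "'a set" and n :: nat and \<mu> :: real
  assumes "group G" and "finite (carrier G)"
    and "bij_betw e {..<card (carrier G)} (carrier G)"
    and "S \<subseteq> carrier G - {\<one>\<^bsub>G\<^esub>}" and "T \<subseteq> carrier G - {\<one>\<^bsub>G\<^esub>}"
    and "S \<inter> T = {}" and "carrier G - {\<one>\<^bsub>G\<^esub>} = S \<union> T"
    and "S = set_inv\<^bsub>G\<^esub> S" and "T = set_inv\<^bsub>G\<^esub> T"
    and "n = card (carrier G) + 1" and "\<mu> = real (card S) - real (card T)"
  shows "((\<exists>k. quasi_signature_set G e S n k) \<longleftrightarrow>
            (\<forall>g\<in>S. real (num_factorizations G S S g) = (real n + 3 * \<mu> - 6) / 4) \<and>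
            (\<forall>h\<in>T. real (num_factorizations G T T h) = (real n - 3 * \<mu> - 6) / 4))
         \<and> (\<forall>k. quasi_signature_set G e S n k \<longrightarrow>
              \<mu> = (real n - 2 * real k) * sqrt ((real n - 1) / (real k * (real n - real k))) \<and>
              real k = real n / 2 - \<mu> * real n / (2 * sqrt (4 * (real n - 1) + \<mu>\<^sup>2)))"
proof -
  interpret P: inverse_closed_partition G e S T
    by (intro inverse_closed_partition.intro inverse_closed_partition_axioms.intro
        assms(1,2,3,6,7) assms(8)[symmetric])
  have exists_iff: "(\<exists>k. quasi_signature_set G e S n k) \<longleftrightarrow>
      (\<forall>g\<in>carrier G - {\<one>\<^bsub>G\<^esub>}. 1 + sign_convolution G S g = \<mu> * signed_indicator G S g)"
  proof
    assume "\<exists>k. quasi_signature_set G e S n k"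
    then obtain k where "quasi_signature_set G e S n k" ..
    then show "\<forall>g\<in>carrier G - {\<one>\<^bsub>G\<^esub>}. 1 + sign_convolution G S g = \<mu> * signed_indicator G S g"
      using P.quasi_signature_set_imp[of k] unfolding assms(10,11) by fast
  next
    assume "\<forall>g\<in>carrier G - {\<one>\<^bsub>G\<^esub>}. 1 + sign_convolution G S g = \<mu> * signed_indicator G S g"
    then show "\<exists>k. quasi_signature_set G e S n k"
      unfolding assms(10,11) by (rule P.quasi_signature_set_exists)
  qed
  have parameters: "\<mu> = frame_parameter n k \<and>
      real k = real n / 2 - \<mu> * real n / (2 * sqrt (4 * (real n - 1) + \<mu>\<^sup>2))"
    if "quasi_signature_set G e S n k" for k
    using P.quasi_signature_set_imp[of k] dimension_from_frame_parameter[of k n] that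
    by (simp add: assms(10,11))
  show ?thesis
    unfolding exists_iff P.convolution_equation_iff_counts[folded assms(10,11)]
    using parameters unfolding frame_parameter_def by blast
qed

end
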